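(* Let $\Sigma$ be a compact Riemann surface with $\partial\Sigma=\emptyset$ and let $D\subset\Sigma$ be a finite subset. Then the regularized integral $\operatorname{Reg}\!\int_\Sigma:\mathcal A^2(\Sigma,\star D)\to\mathbb C$ factors through the quotient $$\operatorname{Reg}\!\int_\Sigma:\ \frac{\mathcal A^2(\Sigma,\star D)}{\partial\mathcal A^{0,1}(\Sigma,\star D)}\to\mathbb C.$$
   Context: $\mathcal A^{p,q}(\Sigma,\star D)$ is the space of complex-valued $(p,q)$-forms which are smooth on $\Sigma\setminus D$ and which near each $p\in D$ have the form $\alpha_0/z^N$, where $z$ is a local holomorphic coordinate with $z(p)=0$, $N\ge0$ is an integer and $\alpha_0$ is a smooth form near $p$. $\mathcal A^2(\Sigma,\star D)=\mathcal A^{1,1}(\Sigma,\star D)$. $\mathcal A^2(\Sigma,\log D)$ is the subspace of forms which near each $p\in D$ have the form $\frac{dz}z\wedge\beta_0$ with $\beta_0$ a smooth $(0,1)$-form. $\partial$ is the holomorphic de Rham differential. Every $\omega\in\mathcal A^2(\Sigma,\star D)$ can be written $\omega=\alpha+\partial\beta$ with $\alpha\in\mathcal A^2(\Sigma,\log D)$, $\beta\in\mathcal A^{0,1}(\Sigma,\star D)$, and the regularized integral is $\operatorname{Reg}\!\int_\Sigma\omega:=\int_\Sigma\alpha$, which is absolutely convergent and independent of the choice of $\alpha,\beta$. *)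

theory Defs
  imports "HOL-Analysis.Analysis" "HOL-Library.Function_Algebras"
begin

section \<open>Smooth functions and the Wirtinger derivative\<close>

definition partial_x :: "(complex \<Rightarrow> complex) \<Rightarrow> complex \<Rightarrow> complex" where
  "partial_x f z = frechet_derivative f (at z) 1"

definition partial_y :: "(complex \<Rightarrow> complex) \<Rightarrow> complex \<Rightarrow> complex" where
  "partial_y f z = frechet_derivative f (at z) \<i>"

text \<open>Real differentiability of class C^k; only meaningful for open \<open>S\<close>.\<close>

primrec Ck_on :: "nat \<Rightarrow> (complex \<Rightarrow> complex) \<Rightarrow> complex set \<Rightarrow> bool" where
  "Ck_on 0 f S \<longleftrightarrow> continuous_on S f"
| "Ck_on (Suc k) f S \<longleftrightarrow>
     (\<forall>z\<in>S. f differentiable (at z)) \<and> Ck_on k (partial_x f) S \<and> Ck_on k (partial_y f) S"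

definition smooth_on :: "complex set \<Rightarrow> (complex \<Rightarrow> complex) \<Rightarrow> bool" where
  "smooth_on S f \<longleftrightarrow> (\<forall>k. Ck_on k f S)"

definition wirtinger :: "(complex \<Rightarrow> complex) \<Rightarrow> complex \<Rightarrow> complex" where
  "wirtinger f z = (partial_x f z - \<i> * partial_y f z) / 2"


section \<open>Riemann surfaces\<close>

type_synonym 'a chart = "'a set \<times> ('a \<Rightarrow> complex)"

definition is_chart :: "'a topology \<Rightarrow> 'a chart \<Rightarrow> bool" where
  "is_chart X c \<longleftrightarrow> openin X (fst c) \<and> open (snd c ` fst c) \<and>
     homeomorphic_map (subtopology X (fst c)) (top_of_set (snd c ` fst c)) (snd c)"

definition transition :: "'a chart \<Rightarrow> 'a chart \<Rightarrow> complex \<Rightarrow> complex" where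
  "transition c d = snd d \<circ> inv_into (fst c) (snd c)"

definition compatible :: "'a chart \<Rightarrow> 'a chart \<Rightarrow> bool" where
  "compatible c d \<longleftrightarrow>
     transition c d holomorphic_on (snd c ` (fst c \<inter> fst d)) \<and>
     transition d c holomorphic_on (snd d ` (fst c \<inter> fst d))"

definition holomorphic_atlas :: "'a topology \<Rightarrow> 'a chart set \<Rightarrow> bool" where
  "holomorphic_atlas X A \<longleftrightarrow>
     (\<forall>c\<in>A. is_chart X c) \<and> (\<Union>c\<in>A. fst c) = topspace X \<and> (\<forall>c\<in>A. \<forall>d\<in>A. compatible c d)"

text \<open>The maximal atlas generated by \<open>A\<close>: all local holomorphic coordinates.\<close>

definition charts :: "'a topology \<Rightarrow> 'a chart set \<Rightarrow> 'a chart set" where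
  "charts X A = {c. is_chart X c \<and> (\<forall>d\<in>A. compatible c d)}"

text \<open>All charts map onto open subsets of the complex plane, so the boundary is empty.
  Second countability follows from compactness.\<close>

definition compact_riemann_surface :: "'a topology \<Rightarrow> 'a chart set \<Rightarrow> bool" where
  "compact_riemann_surface X A \<longleftrightarrow>
     compact_space X \<and> Hausdorff_space X \<and> connected_space X \<and> topspace X \<noteq> {} \<and>
     holomorphic_atlas X A"

definition coordinate_at :: "'a topology \<Rightarrow> 'a chart set \<Rightarrow> 'a \<Rightarrow> 'a chart \<Rightarrow> bool" where
  "coordinate_at X A p c \<longleftrightarrow> c \<in> charts X A \<and> p \<in> fst c \<and> snd c p = 0"


section \<open>Differential forms with poles\<close>

text \<open>A form of type (p,q), with \<open>p, q \<le> 1\<close>, on the complement of \<open>D\<close> is the family of its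
  coefficients: \<open>w c z\<close> is the coefficient of 1, \<open>dz\<close>, \<open>d\<zbar>\<close> or
  \<open>dz \<and> d\<zbar>\<close> in the coordinate \<open>z\<close> given by the chart \<open>c\<close>.
  Coefficients are set to 0 wherever they are not meaningful, which includes the points of
  \<open>D\<close>; thus equality of families is equality of forms on the complement of \<open>D\<close>.\<close>

type_synonym 'a form = "'a chart \<Rightarrow> complex \<Rightarrow> complex"

definition smooth_forms ::
  "nat \<Rightarrow> nat \<Rightarrow> 'a topology \<Rightarrow> 'a chart set \<Rightarrow> 'a set \<Rightarrow> 'a form set" where
  "smooth_forms p q X A D = {w.
     (\<forall>c z. \<not> (c \<in> charts X A \<and> z \<in> snd c ` (fst c - D)) \<longrightarrow> w c z = 0) \<and>
     (\<forall>c\<in>charts X A. smooth_on (snd c ` (fst c - D)) (w c)) \<and>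
     (\<forall>c\<in>charts X A. \<forall>d\<in>charts X A. \<forall>z\<in>snd c ` (fst c \<inter> fst d - D).
        w c z = w d (transition c d z) *
          deriv (transition c d) z ^ p * cnj (deriv (transition c d) z) ^ q)}"

text \<open>Near the origin, the coefficient \<open>w c\<close> is a smooth function divided by \<open>z ^ N\<close>.\<close>

definition pole_le :: "'a set \<Rightarrow> 'a \<Rightarrow> 'a chart \<Rightarrow> nat \<Rightarrow> 'a form \<Rightarrow> bool" where
  "pole_le D p c N w \<longleftrightarrow>
     (\<exists>V f. open V \<and> 0 \<in> V \<and> V \<subseteq> snd c ` (fst c - (D - {p})) \<and> smooth_on V f \<and>
        (\<forall>z\<in>V - {0}. w c z = f z / z ^ N))"

text \<open>The pole conditions do not depend on the coordinate centred at the point, since two such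
  coordinates differ by a nowhere vanishing holomorphic factor.\<close>

definition star_forms ::
  "nat \<Rightarrow> nat \<Rightarrow> 'a topology \<Rightarrow> 'a chart set \<Rightarrow> 'a set \<Rightarrow> 'a form set" where
  "star_forms p q X A D = {w \<in> smooth_forms p q X A D.
     \<forall>x\<in>D. \<forall>c. coordinate_at X A x c \<longrightarrow> (\<exists>N. pole_le D x c N w)}"

abbreviation star_2_forms :: "'a topology \<Rightarrow> 'a chart set \<Rightarrow> 'a set \<Rightarrow> 'a form set" where
  "star_2_forms \<equiv> star_forms 1 1"

text \<open>With \<open>\<beta>\<^sub>0 = f d\<zbar>\<close>, the form \<open>(dz/z) \<and> \<beta>\<^sub>0\<close> has
  coefficient \<open>f / z\<close>.\<close>

definition log_2_forms :: "'a topology \<Rightarrow> 'a chart set \<Rightarrow> 'a set \<Rightarrow> 'a form set" where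
  "log_2_forms X A D = {w \<in> star_2_forms X A D.
     \<forall>x\<in>D. \<forall>c. coordinate_at X A x c \<longrightarrow> pole_le D x c 1 w}"

text \<open>The operator \<open>\<partial>\<close> on (0,1)-forms:
  \<open>\<partial>(b d\<zbar>) = (\<partial>b/\<partial>z) dz \<and> d\<zbar>\<close>.\<close>

definition del :: "'a topology \<Rightarrow> 'a chart set \<Rightarrow> 'a set \<Rightarrow> 'a form \<Rightarrow> 'a form" where
  "del X A D w = (\<lambda>c z. if c \<in> charts X A \<and> z \<in> snd c ` (fst c - D) then wirtinger (w c) z else 0)"

definition scale_form :: "complex \<Rightarrow> 'a form \<Rightarrow> 'a form" where
  "scale_form a w = (\<lambda>c z. a * w c z)"


section \<open>Integration of 2-forms\<close>

text \<open>The surface is cut into finitely many disjoint Borel pieces, each lying in a chart; by the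
  change of variables formula neither integrability nor the integral depends on the pieces.
  The factor below is \<open>dz \<and> d\<zbar> = -2\<i> dx \<and> dy\<close>.\<close>

definition decomposition :: "'a topology \<Rightarrow> 'a chart set \<Rightarrow> ('a chart \<times> 'a set) set \<Rightarrow> bool" where
  "decomposition X A P \<longleftrightarrow> finite P \<and>
     (\<forall>(c, E)\<in>P. c \<in> charts X A \<and> E \<subseteq> fst c \<and> snd c ` E \<in> sets borel) \<and>
     pairwise (\<lambda>(c, E) (d, F). E \<inter> F = {}) P \<and>
     (\<Union>(c, E)\<in>P. E) = topspace X"

definition form_integrable :: "'a topology \<Rightarrow> 'a chart set \<Rightarrow> 'a form \<Rightarrow> bool" where
  "form_integrable X A w \<longleftrightarrow>
     (\<forall>P. decomposition X A P \<longrightarrow> (\<forall>(c, E)\<in>P. set_integrable lborel (snd c ` E) (w c)))"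

definition form_integral :: "'a topology \<Rightarrow> 'a chart set \<Rightarrow> 'a form \<Rightarrow> complex" where
  "form_integral X A w =
     (let P = (SOME P. decomposition X A P)
      in \<Sum>(c, E)\<in>P. - 2 * \<i> * set_lebesgue_integral lborel (snd c ` E) (w c))"


section \<open>The regularized integral\<close>

definition reg_integral :: "'a topology \<Rightarrow> 'a chart set \<Rightarrow> 'a set \<Rightarrow> 'a form \<Rightarrow> complex" where
  "reg_integral X A D w =
     (THE I. \<exists>\<alpha>\<in>log_2_forms X A D. \<exists>\<beta>\<in>star_forms 0 1 X A D.
        w = \<alpha> + del X A D \<beta> \<and> I = form_integral X A \<alpha>)"

text \<open>The facts that make the previous description a good definition: decompositions exist,
  their logarithmic parts are absolutely integrable, and the integral is independent of the
  decomposition.\<close>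

definition reg_integral_well_defined :: "'a topology \<Rightarrow> 'a chart set \<Rightarrow> 'a set \<Rightarrow> bool" where
  "reg_integral_well_defined X A D \<longleftrightarrow>
     (\<forall>w\<in>star_2_forms X A D. \<exists>\<alpha>\<in>log_2_forms X A D. \<exists>\<beta>\<in>star_forms 0 1 X A D.
        w = \<alpha> + del X A D \<beta>) \<and>
     (\<forall>\<alpha>\<in>log_2_forms X A D. form_integrable X A \<alpha>) \<and>
     (\<forall>\<alpha>\<in>log_2_forms X A D. \<forall>\<alpha>'\<in>log_2_forms X A D.
        \<forall>\<beta>\<in>star_forms 0 1 X A D. \<forall>\<beta>'\<in>star_forms 0 1 X A D.
        \<alpha> + del X A D \<beta> = \<alpha>' + del X A D \<beta>' \<longrightarrow>
        form_integral X A \<alpha> = form_integral X A \<alpha>')"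

definition exact_rel :: "'a topology \<Rightarrow> 'a chart set \<Rightarrow> 'a set \<Rightarrow> ('a form \<times> 'a form) set" where
  "exact_rel X A D =
     {(v, w) \<in> star_2_forms X A D \<times> star_2_forms X A D. v - w \<in> del X A D ` star_forms 0 1 X A D}"

end

theory Submission
  imports Defs
begin

text \<open>If \<open>v - w = \<partial>\<gamma>\<close>, then \<open>v = \<alpha> + \<partial>\<beta>\<close> holds exactly when
  \<open>w = \<alpha> + \<partial>(\<beta> - \<gamma>)\<close>, so \<open>v\<close> and \<open>w\<close> have the same logarithmic parts and hence the
  same regularized integral, whether or not that integral is well defined. For linearity one adds
  representations \<open>\<alpha> + \<partial>\<beta>\<close>; the integral of the logarithmic parts is linear because compactness
  provides a decomposition into finitely many Borel pieces.\<close>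

section \<open>Smooth functions\<close>

lemma Ck_on_subset: "Ck_on k f S \<Longrightarrow> T \<subseteq> S \<Longrightarrow> Ck_on k f T"
  by (induction k arbitrary: f) (auto intro: continuous_on_subset)

text \<open>Openness makes the derivative at a point of \<open>S\<close> depend only on values in
  \<open>S\<close>, so equality on \<open>S\<close> passes to both partials and the induction
  continues.\<close>

lemma Ck_on_cong:
  assumes "open S" "\<And>z. z \<in> S \<Longrightarrow> f z = g z" "Ck_on k f S"
  shows "Ck_on k g S"
  using assms(2,3)
proof (induction k arbitrary: f g)
  case 0
  then show ?case by (metis Ck_on.simps(1) continuous_on_cong)
next
  case (Suc k)
  have D: "(g has_derivative frechet_derivative f (at z)) (at z)" if "z \<in> S" for z
    using Suc.prems that assms(1) frechet_derivative_works has_derivative_transform_within_open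
    by (metis Ck_on.simps(2))
  then have "frechet_derivative f (at z) = frechet_derivative g (at z)" if "z \<in> S" for z
    using that frechet_derivative_at by blast
  then have "\<And>z. z \<in> S \<Longrightarrow> partial_x f z = partial_x g z"
    "\<And>z. z \<in> S \<Longrightarrow> partial_y f z = partial_y g z"
    by (simp_all add: partial_x_def partial_y_def)
  then have "Ck_on k (partial_x g) S" "Ck_on k (partial_y g) S"
    using Suc.IH Suc.prems(2) by (metis Ck_on.simps(2))+
  then show ?case using D differentiable_def by auto
qed

text \<open>At the bottom level this is continuity of differentiable functions; higher levels apply
  the induction hypothesis to the partials.\<close>

lemma Ck_on_Suc_imp: "Ck_on (Suc k) f S \<Longrightarrow> Ck_on k f S"
proof (induction k arbitrary: f)
  case 0
  then show ?case
    by (auto intro!: differentiable_imp_continuous_on differentiable_at_imp_differentiable_on)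
next
  case (Suc k)
  then show ?case by (metis Ck_on.simps(2))
qed

text \<open>Uniqueness of the Frechet derivative turns the sum and product rules into identities of
  linear maps, which are then evaluated at 1 and \<i>.\<close>

lemma
  assumes "f differentiable at z" "g differentiable at z"
  shows partial_x_add: "partial_x (\<lambda>z. f z + g z) z = partial_x f z + partial_x g z"
    and partial_y_add: "partial_y (\<lambda>z. f z + g z) z = partial_y f z + partial_y g z"
    and partial_x_mult: "partial_x (\<lambda>z. f z * g z) z = f z * partial_x g z + partial_x f z * g z"
    and partial_y_mult: "partial_y (\<lambda>z. f z * g z) z = f z * partial_y g z + partial_y f z * g z"
proof -
  have f: "(f has_derivative frechet_derivative f (at z)) (at z)"
    and g: "(g has_derivative frechet_derivative g (at z)) (at z)"
    using assms frechet_derivative_works by blast+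
  note add = frechet_derivative_at[OF has_derivative_add[OF f g], symmetric]
  note mult = frechet_derivative_at[OF has_derivative_mult[OF f g], symmetric]
  show "partial_x (\<lambda>z. f z + g z) z = partial_x f z + partial_x g z"
    "partial_y (\<lambda>z. f z + g z) z = partial_y f z + partial_y g z"
    "partial_x (\<lambda>z. f z * g z) z = f z * partial_x g z + partial_x f z * g z"
    "partial_y (\<lambda>z. f z * g z) z = f z * partial_y g z + partial_y f z * g z"
    by (simp_all add: partial_x_def partial_y_def add mult)
qed

lemma Ck_on_add:
  assumes "open S" "Ck_on k f S" "Ck_on k g S"
  shows "Ck_on k (\<lambda>z. f z + g z) S"
  using assms(2,3)
proof (induction k arbitrary: f g)
  case 0
  then show ?case by (simp add: continuous_on_add)
next
  case (Suc k)
  have "Ck_on k (partial_x (\<lambda>z. f z + g z)) S"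
    by (rule Ck_on_cong[OF assms(1) _ Suc.IH[of "partial_x f" "partial_x g"]])
      (use Suc.prems in \<open>auto simp: partial_x_add\<close>)
  moreover have "Ck_on k (partial_y (\<lambda>z. f z + g z)) S"
    by (rule Ck_on_cong[OF assms(1) _ Suc.IH[of "partial_y f" "partial_y g"]])
      (use Suc.prems in \<open>auto simp: partial_y_add\<close>)
  ultimately show ?case using Suc.prems by (auto intro: differentiable_add)
qed

lemma Ck_on_mult:
  assumes "open S" "Ck_on k f S" "Ck_on k g S"
  shows "Ck_on k (\<lambda>z. f z * g z) S"
  using assms(2,3)
proof (induction k arbitrary: f g)
  case 0
  then show ?case by (simp add: continuous_on_mult)
next
  case (Suc k)
  \<comment> \<open>The product rule leaves one factor undifferentiated, so the induction hypothesis
    needs the factors themselves at level \<open>k\<close>.\<close>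
  have fg: "Ck_on k f S" "Ck_on k g S"
    using Suc.prems by (blast intro: Ck_on_Suc_imp)+
  have "Ck_on k (partial_x (\<lambda>z. f z * g z)) S"
    by (rule Ck_on_cong[OF assms(1) _
          Ck_on_add[OF assms(1) Suc.IH[of f "partial_x g"] Suc.IH[of "partial_x f" g]]])
      (use Suc.prems fg in \<open>auto simp: partial_x_mult\<close>)
  moreover have "Ck_on k (partial_y (\<lambda>z. f z * g z)) S"
    by (rule Ck_on_cong[OF assms(1) _
          Ck_on_add[OF assms(1) Suc.IH[of f "partial_y g"] Suc.IH[of "partial_y f" g]]])
      (use Suc.prems fg in \<open>auto simp: partial_y_mult\<close>)
  ultimately show ?case using Suc.prems by (auto intro: differentiable_mult)
qed

text \<open>With \<open>a\<close> arbitrary, the induction hypothesis covers the zero function that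
  arises as both partials.\<close>

lemma Ck_on_const: "Ck_on k (\<lambda>z. a) S"
proof (induction k arbitrary: a)
  case (Suc k)
  have "partial_x (\<lambda>z. a) = (\<lambda>z. 0)" "partial_y (\<lambda>z. a) = (\<lambda>z. 0)"
    by (auto simp: partial_x_def partial_y_def)
  then show ?case using Suc by simp
qed simp

lemma Ck_on_ident: "Ck_on k (\<lambda>z. z) S"
proof (cases k)
  case (Suc n)
  have "partial_x (\<lambda>z. z) = (\<lambda>z. 1)" "partial_y (\<lambda>z. z) = (\<lambda>z. \<i>)"
    by (auto simp: partial_x_def partial_y_def)
  then show ?thesis using Suc by (simp add: Ck_on_const)
qed simp

lemma smooth_on_subset: "smooth_on S f \<Longrightarrow> T \<subseteq> S \<Longrightarrow> smooth_on T f"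
  by (auto simp: smooth_on_def intro: Ck_on_subset)

lemma smooth_on_const: "smooth_on S (\<lambda>z. a)"
  by (simp add: smooth_on_def Ck_on_const)

lemma smooth_on_mult:
  "open S \<Longrightarrow> smooth_on S f \<Longrightarrow> smooth_on S g \<Longrightarrow> smooth_on S (\<lambda>z. f z * g z)"
  by (simp add: smooth_on_def Ck_on_mult)

text \<open>Powers of the coordinate serve as numerators when a pole order is raised.\<close>

lemma smooth_on_power: "open S \<Longrightarrow> smooth_on S (\<lambda>z. z ^ n)"
proof (induction n)
  case (Suc n)
  then show ?case
    using smooth_on_mult[of S "\<lambda>z. z"] by (simp add: smooth_on_def Ck_on_ident)
qed (simp add: smooth_on_const)

lemma smooth_on_linear_combination:
  assumes "open S" "smooth_on S f" "smooth_on S g"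
  shows "smooth_on S (\<lambda>z. a * f z + b * g z)"
  using assms smooth_on_mult[OF assms(1) smooth_on_const]
  by (simp add: smooth_on_def Ck_on_add)

lemma smooth_on_imp_differentiable: "smooth_on S f \<Longrightarrow> z \<in> S \<Longrightarrow> f differentiable at z"
  unfolding smooth_on_def by (metis Ck_on.simps(2))

text \<open>Complex scalars are treated as constant factors in the product rule, which gives complex
  linearity although only real derivatives are involved.\<close>

lemma wirtinger_linear_combination:
  assumes "f differentiable at z" "g differentiable at z"
  shows "wirtinger (\<lambda>z. a * f z + b * g z) z = a * wirtinger f z + b * wirtinger g z"
proof -
  have "partial_x (\<lambda>z. c) z = 0" "partial_y (\<lambda>z. c) z = 0" for c
    by (simp_all add: partial_x_def partial_y_def)
  then show ?thesis
    using assms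
    by (simp add: wirtinger_def partial_x_add partial_y_add partial_x_mult partial_y_mult
        field_simps)
qed


section \<open>Charts and decompositions\<close>

text \<open>A chart is an open map onto its image, and that image is open in the plane, so
  relatively open sets there are open.\<close>

lemma open_chart_image:
  assumes "is_chart X c" "openin X U"
  shows "open (snd c ` (fst c \<inter> U))"
proof -
  have "open_map (subtopology X (fst c)) (top_of_set (snd c ` fst c)) (snd c)"
    using assms(1) homeomorphic_imp_open_map unfolding is_chart_def by blast
  then have "openin (top_of_set (snd c ` fst c)) (snd c ` (fst c \<inter> U))"
    using assms(2) unfolding open_map_def by (metis Int_commute openin_subtopology)
  then show ?thesis
    using assms(1) openin_open_trans unfolding is_chart_def by blast
qed

lemma inj_on_chart:
  assumes "is_chart X c"
  shows "inj_on (snd c) (fst c)"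
proof -
  have "topspace (subtopology X (fst c)) = fst c"
    using assms openin_subset by (auto simp: is_chart_def)
  then show ?thesis
    using assms homeomorphic_imp_injective_map unfolding is_chart_def by metis
qed

text \<open>Finite sets are closed in a Hausdorff space. The set \<open>F\<close> will be
  \<open>D\<close>, or \<open>D\<close> without the point at which a pole is examined.\<close>

lemma open_chart_image_diff_finite:
  assumes "Hausdorff_space X" "finite F" "F \<subseteq> topspace X" "is_chart X c"
  shows "open (snd c ` (fst c - F))"
proof -
  have "closedin X F"
    using assms closedin_Hausdorff_finite by blast
  then have "openin X (topspace X - F)" by blast
  moreover have "fst c - F = fst c \<inter> (topspace X - F)"
    using assms(4) openin_subset by (auto simp: is_chart_def)
  ultimately show ?thesis
    using open_chart_image[OF assms(4)] by simp
qed

text \<open>Compactness gives a finite cover by chart domains; listing them and removing from each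
  the earlier ones makes the pieces disjoint.\<close>

lemma decomposition_exists:
  assumes "compact_space X" "holomorphic_atlas X A"
  shows "\<exists>P. decomposition X A P"
proof -
  have chart: "is_chart X c" "c \<in> charts X A" if "c \<in> A" for c
    using assms(2) that by (auto simp: holomorphic_atlas_def charts_def)
  have "\<exists>F. finite F \<and> F \<subseteq> fst ` A \<and> topspace X \<subseteq> \<Union>F"
    using assms chart(1)
    by (intro compact_space_alt[THEN iffD1, rule_format])
      (auto simp: holomorphic_atlas_def is_chart_def)
  then obtain B where B: "finite B" "B \<subseteq> A" "topspace X \<subseteq> (\<Union>c\<in>B. fst c)"
    by (metis finite_subset_image)
  obtain cs where cs: "set cs = B" "distinct cs"
    using finite_distinct_list[OF B(1)] by blast
  define E where "E i = fst (cs ! i) - (\<Union>j<i. fst (cs ! j))" for i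
  define P where "P = (\<lambda>i. (cs ! i, E i)) ` {..<length cs}"
  have mem: "cs ! i \<in> A" if "i < length cs" for i
    using that cs(1) B(2) nth_mem by blast
  have borel: "snd (cs ! i) ` E i \<in> sets borel" if i: "i < length cs" for i
  proof -
    let ?c = "cs ! i"
    let ?U = "\<Union>j<i. fst (cs ! j)"
    have U: "openin X ?U"
    proof (intro openin_Union ballI)
      show "openin X V" if "V \<in> (\<lambda>j. fst (cs ! j)) ` {..<i}" for V
        using that i chart(1)[OF mem] by (auto simp: is_chart_def)
    qed
    \<comment> \<open>Injectivity of the chart lets the image commute with the set difference, so
      the piece becomes a difference of two open sets.\<close>
    have "snd ?c ` E i = snd ?c ` fst ?c - snd ?c ` (fst ?c \<inter> ?U)"
      using inj_on_chart[OF chart(1)[OF mem[OF i]]] by (auto simp: E_def inj_on_def)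
    moreover have "open (snd ?c ` fst ?c)"
      using chart(1)[OF mem[OF i]] by (simp add: is_chart_def)
    ultimately show ?thesis
      using open_chart_image[OF chart(1)[OF mem[OF i]] U] by (simp add: sets.Diff)
  qed
  have disj: "E i \<inter> E j = {}" if "i \<noteq> j" for i j
    using that by (cases i j rule: linorder_cases) (auto simp: E_def)
  have "x \<in> (\<Union>i<length cs. E i)" if "x \<in> topspace X" for x
  proof -
    have "\<exists>i. i < length cs \<and> x \<in> fst (cs ! i)"
      using that B(3) cs(1) by (metis UN_E in_set_conv_nth subsetD)
    \<comment> \<open>The least index whose domain contains \<open>x\<close> is the one whose piece
      retains \<open>x\<close>.\<close>
    then obtain i where "i < length cs" "x \<in> fst (cs ! i)"
        "\<forall>j<i. \<not> (j < length cs \<and> x \<in> fst (cs ! j))"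
      using exists_least_iff[of "\<lambda>i. i < length cs \<and> x \<in> fst (cs ! i)"] by blast
    then show ?thesis by (force simp: E_def)
  qed
  moreover have "E i \<subseteq> topspace X" if "i < length cs" for i
    using chart(1)[OF mem[OF that]] openin_subset by (auto simp: is_chart_def E_def)
  ultimately have "(\<Union>(c, F)\<in>P. F) = topspace X"
    by (auto simp: P_def)
  moreover have "pairwise (\<lambda>(c, E) (d, F). E \<inter> F = {}) P"
  proof (rule pairwiseI)
    fix x y assume "x \<in> P" "y \<in> P" "x \<noteq> y"
    then obtain i j where "x = (cs ! i, E i)" "y = (cs ! j, E j)" "i \<noteq> j"
      by (auto simp: P_def)
    then show "(\<lambda>(c, E) (d, F). E \<inter> F = {}) x y" by (simp add: disj)
  qed
  moreover have "\<forall>(c, F)\<in>P. c \<in> charts X A \<and> F \<subseteq> fst c \<and> snd c ` F \<in> sets borel"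
    using mem chart(2) borel by (auto simp: P_def E_def)
  moreover have "finite P" by (simp add: P_def)
  ultimately have "decomposition X A P" by (simp add: decomposition_def)
  then show ?thesis ..
qed


section \<open>Linear structure on forms\<close>

lemma linear_combination_apply:
  "(scale_form a v + scale_form b w) c z = a * v c z + b * w c z"
  by (simp add: scale_form_def)

text \<open>Through this identity, closure under differences and additivity of \<partial> are
  instances of the statements on linear combinations.\<close>

lemma form_diff_eq_linear_combination: "v - w = scale_form 1 v + scale_form (- 1) w"
  by (intro ext) (simp add: scale_form_def)

text \<open>Expanding the fraction by \<open>z ^ (N - M)\<close> keeps the numerator smooth. This
  allows two forms to be brought to a common pole order.\<close>

lemma pole_le_mono:
  assumes "pole_le D p c M w" "M \<le> N"
  shows "pole_le D p c N w"
proof -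
  obtain V f where V: "open V" "0 \<in> V" "V \<subseteq> snd c ` (fst c - (D - {p}))" "smooth_on V f"
      "\<forall>z\<in>V - {0}. w c z = f z / z ^ M"
    using assms(1) unfolding pole_le_def by blast
  have "smooth_on V (\<lambda>z. f z * z ^ (N - M))"
    using V by (intro smooth_on_mult smooth_on_power)
  moreover have "f z * z ^ (N - M) / z ^ N = f z / z ^ M" if "z \<noteq> 0" for z
    using assms(2) that by (simp add: power_diff)
  ultimately show ?thesis
    using V unfolding pole_le_def
    by (intro exI[of _ V] exI[of _ "\<lambda>z. f z * z ^ (N - M)"]) simp
qed

text \<open>On the intersection of the two neighbourhoods the denominators agree, so the numerators
  can be combined.\<close>

lemma pole_le_linear_combination:
  assumes "pole_le D p c N v" "pole_le D p c N w"
  shows "pole_le D p c N (scale_form a v + scale_form b w)"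
proof -
  obtain V f where V: "open V" "0 \<in> V" "V \<subseteq> snd c ` (fst c - (D - {p}))" "smooth_on V f"
      "\<forall>z\<in>V - {0}. v c z = f z / z ^ N"
    using assms(1) unfolding pole_le_def by blast
  obtain W g where W: "open W" "0 \<in> W" "smooth_on W g" "\<forall>z\<in>W - {0}. w c z = g z / z ^ N"
    using assms(2) unfolding pole_le_def by blast
  have "smooth_on (V \<inter> W) (\<lambda>z. a * f z + b * g z)"
    using V W by (intro smooth_on_linear_combination) (auto intro: smooth_on_subset)
  then show ?thesis
    using V W unfolding pole_le_def
    by (intro exI[of _ "V \<inter> W"] exI[of _ "\<lambda>z. a * f z + b * g z"])
      (auto simp: scale_form_def add_divide_distrib)
qed

section \<open>Forms on a fixed compact Riemann surface with finite polar set\<close>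

context
  fixes X :: "'a topology" and A :: "'a chart set" and D :: "'a set"
  assumes X: "compact_riemann_surface X A" and D: "finite D" "D \<subseteq> topspace X"
begin

lemma open_punctured_chart_image: "c \<in> charts X A \<Longrightarrow> open (snd c ` (fst c - D))"
  using X D by (auto simp: compact_riemann_surface_def charts_def
      intro: open_chart_image_diff_finite)

text \<open>All three conditions are preserved: smoothness on the open punctured chart images, the
  transformation law, which is linear in the coefficients, and vanishing where a coefficient is not
  meaningful.\<close>

lemma smooth_forms_linear_combination:
  assumes "v \<in> smooth_forms p q X A D" "w \<in> smooth_forms p q X A D"
  shows "scale_form a v + scale_form b w \<in> smooth_forms p q X A D"
proof -
  let ?u = "scale_form a v + scale_form b w"
  have "smooth_on (snd c ` (fst c - D)) (?u c)" if "c \<in> charts X A" for c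
  proof -
    have "?u c = (\<lambda>z. a * v c z + b * w c z)"
      by (rule ext) (rule linear_combination_apply)
    then show ?thesis
      using assms that open_punctured_chart_image[OF that]
      by (simp add: smooth_forms_def smooth_on_linear_combination)
  qed
  moreover have "?u c z = ?u d (transition c d z) *
      deriv (transition c d) z ^ p * cnj (deriv (transition c d) z) ^ q"
    if "c \<in> charts X A" "d \<in> charts X A" "z \<in> snd c ` (fst c \<inter> fst d - D)" for c d z
  proof -
    let ?t = "deriv (transition c d) z ^ p" and ?s = "cnj (deriv (transition c d) z) ^ q"
    have "v c z = v d (transition c d z) * ?t * ?s" "w c z = w d (transition c d z) * ?t * ?s"
      using assms that by (auto simp only: smooth_forms_def mem_Collect_eq)
    then show ?thesis
      unfolding linear_combination_apply by (simp add: algebra_simps)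
  qed
  moreover have "?u c z = 0" if "\<not> (c \<in> charts X A \<and> z \<in> snd c ` (fst c - D))" for c z
    using assms that unfolding smooth_forms_def linear_combination_apply
    by (metis (mono_tags, lifting) add_0 mem_Collect_eq mult_zero_right)
  ultimately show ?thesis
    unfolding smooth_forms_def by blast
qed

text \<open>The pole orders of the two forms at a point may differ; both are raised to their
  maximum.\<close>

lemma star_forms_linear_combination:
  assumes "v \<in> star_forms p q X A D" "w \<in> star_forms p q X A D"
  shows "scale_form a v + scale_form b w \<in> star_forms p q X A D"
proof -
  have "\<exists>N. pole_le D x c N (scale_form a v + scale_form b w)"
    if x: "x \<in> D" "coordinate_at X A x c" for x c
  proof -
    obtain M N where "pole_le D x c M v" "pole_le D x c N w"
      using assms x unfolding star_forms_def by blast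
    then show ?thesis
      by (meson max.cobounded1 max.cobounded2 pole_le_linear_combination pole_le_mono)
  qed
  then show ?thesis
    using assms smooth_forms_linear_combination by (simp add: star_forms_def)
qed

lemma log_2_forms_linear_combination:
  assumes "v \<in> log_2_forms X A D" "w \<in> log_2_forms X A D"
  shows "scale_form a v + scale_form b w \<in> log_2_forms X A D"
  using assms star_forms_linear_combination
  by (simp add: log_2_forms_def pole_le_linear_combination)

text \<open>The pole condition holds with order 0 and zero numerator. The neighbourhood is the whole
  chart image with the other points of \<open>D\<close> removed.\<close>

lemma zero_in_star_forms: "0 \<in> star_forms p q X A D"
proof -
  have "pole_le D x c 0 0" if x: "x \<in> D" "coordinate_at X A x c" for x c
  proof -
    have "open (snd c ` (fst c - (D - {x})))"
      using X D x by (intro open_chart_image_diff_finite)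
        (auto simp: compact_riemann_surface_def coordinate_at_def charts_def)
    moreover have "0 \<in> snd c ` (fst c - (D - {x}))"
      using x by (force simp: coordinate_at_def)
    ultimately show ?thesis
      unfolding pole_le_def using smooth_on_const
      by (intro exI[of _ "snd c ` (fst c - (D - {x}))"] exI[of _ "\<lambda>z. 0"]) auto
  qed
  moreover have "0 \<in> smooth_forms p q X A D"
    using smooth_on_const[of _ 0] by (simp add: smooth_forms_def zero_fun_def)
  ultimately show ?thesis
    unfolding star_forms_def by blast
qed

text \<open>At meaningful points smoothness supplies the differentiability that linearity of
  \<open>wirtinger\<close> requires; elsewhere both sides are 0 by convention.\<close>

lemma del_linear_combination:
  assumes "v \<in> star_forms p q X A D" "w \<in> star_forms p q X A D"
  shows "del X A D (scale_form a v + scale_form b w) =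
    scale_form a (del X A D v) + scale_form b (del X A D w)"
proof (intro ext)
  fix c z
  show "del X A D (scale_form a v + scale_form b w) c z =
    (scale_form a (del X A D v) + scale_form b (del X A D w)) c z"
  proof (cases "c \<in> charts X A \<and> z \<in> snd c ` (fst c - D)")
    case True
    then have "v c differentiable at z" "w c differentiable at z"
      using assms smooth_on_imp_differentiable unfolding star_forms_def smooth_forms_def by blast+
    \<comment> \<open>A derivative acts on the coefficient as a function, so the identity is stated
      between functions rather than at the single point \<open>z\<close>.\<close>
    moreover have "(scale_form a v + scale_form b w) c = (\<lambda>z. a * v c z + b * w c z)"
      by (rule ext) (rule linear_combination_apply)
    ultimately show ?thesis
      using True unfolding linear_combination_apply
      by (simp add: del_def wirtinger_linear_combination del: plus_fun_apply)
  next
    case False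
    then show ?thesis
      unfolding linear_combination_apply by (auto simp: del_def)
  qed
qed

lemma star_forms_diff:
  "v \<in> star_forms p q X A D \<Longrightarrow> w \<in> star_forms p q X A D \<Longrightarrow> v - w \<in> star_forms p q X A D"
  by (simp only: form_diff_eq_linear_combination star_forms_linear_combination)

lemma del_diff:
  "v \<in> star_forms p q X A D \<Longrightarrow> w \<in> star_forms p q X A D \<Longrightarrow>
    del X A D (v - w) = del X A D v - del X A D w"
  by (simp only: form_diff_eq_linear_combination del_linear_combination)

lemma del_zero: "del X A D 0 = 0"
  using del_diff[OF zero_in_star_forms zero_in_star_forms] by (simp only: diff_self)

section \<open>The quotient by exact forms and the factorization\<close>

text \<open>The exact forms contain 0 and are closed under differences, hence form an additive
  subgroup; the relation is congruence modulo it.\<close>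

lemma equiv_exact_rel: "equiv (star_2_forms X A D) (exact_rel X A D)"
proof -
  let ?E = "del X A D ` star_forms 0 1 X A D"
  have zero: "0 \<in> ?E"
    using zero_in_star_forms del_zero by (metis imageI)
  have diff: "u - v \<in> ?E" if uv: "u \<in> ?E" "v \<in> ?E" for u v
  proof -
    obtain \<beta> \<gamma> where bg: "\<beta> \<in> star_forms 0 1 X A D" "\<gamma> \<in> star_forms 0 1 X A D"
        "u = del X A D \<beta>" "v = del X A D \<gamma>"
      using uv by blast
    then show ?thesis
      using imageI[OF star_forms_diff[OF bg(1,2)], of "del X A D"] by (simp only: del_diff)
  qed
  have minus: "w - v \<in> ?E" if "v - w \<in> ?E" for v w
    using diff[OF zero that] by (simp only: diff_0 minus_diff_eq)
  \<comment> \<open>Here \<open>u - w\<close> is written as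
    \<open>(u - v) - (w - v)\<close>.\<close>
  have add: "u - w \<in> ?E" if "u - v \<in> ?E" "v - w \<in> ?E" for u v w
    using diff[OF that(1) minus[OF that(2)]] by (simp only: diff_diff_eq2 diff_add_cancel)
  show ?thesis
  proof (rule equivI)
    show "exact_rel X A D \<subseteq> star_2_forms X A D \<times> star_2_forms X A D"
      by (auto simp: exact_rel_def)
    show "refl_on (star_2_forms X A D) (exact_rel X A D)"
      using zero by (auto simp: refl_on_def exact_rel_def)
    show "sym (exact_rel X A D)"
      using minus unfolding sym_def exact_rel_def by blast
    show "trans (exact_rel X A D)"
      using add unfolding trans_def exact_rel_def by blast
  qed
qed

lemma reg_integral_exact_rel:
  assumes "(v, w) \<in> exact_rel X A D"
  shows "reg_integral X A D v = reg_integral X A D w"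
proof -
  let ?rep = "\<lambda>w I. \<exists>\<alpha>\<in>log_2_forms X A D. \<exists>\<beta>\<in>star_forms 0 1 X A D.
    w = \<alpha> + del X A D \<beta> \<and> I = form_integral X A \<alpha>"
  \<comment> \<open>One direction is proved for arbitrary related forms; symmetry of the relation
    then supplies the converse.\<close>
  have rep: "?rep w I" if vw: "(v, w) \<in> exact_rel X A D" and I: "?rep v I" for v w I
  proof -
    obtain \<gamma> where \<gamma>: "\<gamma> \<in> star_forms 0 1 X A D" "v - w = del X A D \<gamma>"
      using vw by (auto simp: exact_rel_def)
    obtain \<alpha> \<beta> where ab: "\<alpha> \<in> log_2_forms X A D" "\<beta> \<in> star_forms 0 1 X A D"
        "v = \<alpha> + del X A D \<beta>" "I = form_integral X A \<alpha>"
      using I by blast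
    have "w = v - del X A D \<gamma>" by (simp flip: \<gamma>(2))
    then have "w = \<alpha> + del X A D (\<beta> - \<gamma>)"
      by (simp only: ab(3) del_diff[OF ab(2) \<gamma>(1)] add_diff_eq)
    then show ?thesis
      using ab star_forms_diff[OF ab(2) \<gamma>(1)] by blast
  qed
  have "(w, v) \<in> exact_rel X A D"
    using assms equiv_exact_rel by (meson equiv_def symE)
  then have "?rep v = ?rep w"
    using rep assms by (intro ext iffI) blast+
  \<comment> \<open>Equal predicates have the same definite description, even when no unique value
    satisfies them.\<close>
  then show ?thesis by (simp only: reg_integral_def)
qed

section \<open>Linearity of the regularized integral\<close>

text \<open>The decomposition chosen in \<open>form_integral\<close> does not depend on the form, so
  all three integrals are sums over the same pieces and linearity holds piece by piece.\<close>

lemma form_integral_linear_combination: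
  assumes "form_integrable X A v" "form_integrable X A w"
  shows "form_integral X A (scale_form a v + scale_form b w) =
    a * form_integral X A v + b * form_integral X A w"
proof -
  define P where "P = (SOME P. decomposition X A P)"
  \<comment> \<open>Existence guarantees that the choice really is a decomposition, so integrability
    applies on its pieces.\<close>
  have P: "decomposition X A P"
    unfolding P_def using X decomposition_exists
    unfolding compact_riemann_surface_def by (metis someI_ex)
  have int: "set_integrable lborel (snd c ` E) (v c)" "set_integrable lborel (snd c ` E) (w c)"
    if "(c, E) \<in> P" for c E
    using assms P that unfolding form_integrable_def by blast+
  have "set_lebesgue_integral lborel (snd c ` E) ((scale_form a v + scale_form b w) c) =
      a * set_lebesgue_integral lborel (snd c ` E) (v c) +
      b * set_lebesgue_integral lborel (snd c ` E) (w c)" if "(c, E) \<in> P" for c E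
    using int[OF that] by (simp add: scale_form_def plus_fun_def)
  then show ?thesis
    unfolding form_integral_def Let_def P_def[symmetric] sum_distrib_left sum.distrib[symmetric]
    by (intro sum.cong) (auto simp: algebra_simps simp del: plus_fun_apply)
qed

text \<open>The independence clause of well-definedness provides the uniqueness behind
  \<open>THE\<close>, so any representation may be used to compute the value.\<close>

lemma reg_integral_eq_form_integral:
  assumes "reg_integral_well_defined X A D"
    and "\<alpha> \<in> log_2_forms X A D" "\<beta> \<in> star_forms 0 1 X A D"
  shows "reg_integral X A D (\<alpha> + del X A D \<beta>) = form_integral X A \<alpha>"
  unfolding reg_integral_def
proof (rule the_equality)
  show "\<exists>\<alpha>'\<in>log_2_forms X A D. \<exists>\<beta>'\<in>star_forms 0 1 X A D.
      \<alpha> + del X A D \<beta> = \<alpha>' + del X A D \<beta>' \<and> form_integral X A \<alpha> = form_integral X A \<alpha>'"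
    by (intro bexI[OF _ assms(2)] bexI[OF _ assms(3)] conjI refl)
  show "I = form_integral X A \<alpha>"
    if "\<exists>\<alpha>'\<in>log_2_forms X A D. \<exists>\<beta>'\<in>star_forms 0 1 X A D.
      \<alpha> + del X A D \<beta> = \<alpha>' + del X A D \<beta>' \<and> I = form_integral X A \<alpha>'" for I
    using that assms(1)[unfolded reg_integral_well_defined_def, THEN conjunct2, THEN conjunct2]
      assms(2,3) by (elim bexE conjE) metis
qed

lemma reg_integral_linear_combination:
  assumes wd: "reg_integral_well_defined X A D"
    and "v \<in> star_2_forms X A D" "w \<in> star_2_forms X A D"
  shows "reg_integral X A D (scale_form a v + scale_form b w) =
    a * reg_integral X A D v + b * reg_integral X A D w"
proof -
  note wd_unfolded = wd[unfolded reg_integral_well_defined_def]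
  note repr = wd_unfolded[THEN conjunct1]
    and integrable = wd_unfolded[THEN conjunct2, THEN conjunct1, THEN bspec]
  obtain \<alpha> \<beta> where v: "\<alpha> \<in> log_2_forms X A D" "\<beta> \<in> star_forms 0 1 X A D" "v = \<alpha> + del X A D \<beta>"
    using bspec[OF repr assms(2)] by blast
  obtain \<alpha>' \<beta>' where w: "\<alpha>' \<in> log_2_forms X A D" "\<beta>' \<in> star_forms 0 1 X A D" "w = \<alpha>' + del X A D \<beta>'"
    using bspec[OF repr assms(3)] by blast
  \<comment> \<open>Linearity of \<partial> turns the combined representations into a representation
    of the combination.\<close>
  have "scale_form a v + scale_form b w = (scale_form a \<alpha> + scale_form b \<alpha>') +
      del X A D (scale_form a \<beta> + scale_form b \<beta>')"
    by (subst del_linear_combination[OF v(2) w(2)], unfold v(3) w(3), intro ext)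
      (simp add: scale_form_def algebra_simps)
  then have "reg_integral X A D (scale_form a v + scale_form b w) =
      form_integral X A (scale_form a \<alpha> + scale_form b \<alpha>')"
    using reg_integral_eq_form_integral[OF wd log_2_forms_linear_combination[OF v(1) w(1)]
        star_forms_linear_combination[OF v(2) w(2)]] by simp
  also have "\<dots> = a * form_integral X A \<alpha> + b * form_integral X A \<alpha>'"
    by (rule form_integral_linear_combination[OF integrable[OF v(1)] integrable[OF w(1)]])
  finally show ?thesis
    using reg_integral_eq_form_integral[OF wd] v w by simp
qed

end

text \<open>Extensionality fixes the induced map outside the quotient, so that uniqueness concerns
  values on classes only. Linearity is conditional on well-definedness; the factorization is
  not.\<close>

theorem proposition2p7:
  fixes X :: "'a topology" and A :: "'a chart set" and D :: "'a set"
  assumes "compact_riemann_surface X A" and "finite D" and "D \<subseteq> topspace X"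
  shows "\<exists>!R. R \<in> extensional (star_2_forms X A D // exact_rel X A D) \<and>
    (\<forall>w\<in>star_2_forms X A D. R (exact_rel X A D `` {w}) = reg_integral X A D w) \<and>
    (reg_integral_well_defined X A D \<longrightarrow>
      (\<forall>a b. \<forall>v\<in>star_2_forms X A D. \<forall>w\<in>star_2_forms X A D.
        R (exact_rel X A D `` {scale_form a v + scale_form b w}) =
          a * R (exact_rel X A D `` {v}) + b * R (exact_rel X A D `` {w})))"
proof -
  let ?S = "star_2_forms X A D" and ?r = "exact_rel X A D"
  \<comment> \<open>The map evaluates the regularized integral at an arbitrarily chosen
    representative.\<close>
  define R where "R = restrict (\<lambda>C. reg_integral X A D (SOME w. w \<in> C)) (?S // ?r)"
  have R: "R (?r `` {w}) = reg_integral X A D w" if w: "w \<in> ?S" for w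
  proof -
    have "w \<in> ?r `` {w}"
      using equiv_class_self[OF equiv_exact_rel[OF assms] w] .
    then have "(SOME u. u \<in> ?r `` {w}) \<in> ?r `` {w}"
      by (rule someI[where P = "\<lambda>u. u \<in> ?r `` {w}"])
    \<comment> \<open>The chosen representative differs from \<open>w\<close> by an exact form, so
      both have the same regularized integral.\<close>
    then have "(w, SOME u. u \<in> ?r `` {w}) \<in> ?r" by simp
    then show ?thesis
      using w reg_integral_exact_rel[OF assms] by (simp add: R_def quotientI)
  qed
  show ?thesis
  proof (rule ex1I[of _ R], intro conjI impI allI ballI)
    show "R \<in> extensional (?S // ?r)" by (simp add: R_def)
    show "R (?r `` {w}) = reg_integral X A D w" if "w \<in> ?S" for w
      using R that .
    show "R (?r `` {scale_form a v + scale_form b w}) = a * R (?r `` {v}) + b * R (?r `` {w})"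
      if "reg_integral_well_defined X A D" "v \<in> ?S" "w \<in> ?S" for a b v w
      using that R star_forms_linear_combination[OF assms]
        reg_integral_linear_combination[OF assms] by simp
  next
    fix Q
    assume Q: "Q \<in> extensional (?S // ?r) \<and> (\<forall>w\<in>?S. Q (?r `` {w}) = reg_integral X A D w) \<and>
      (reg_integral_well_defined X A D \<longrightarrow> (\<forall>a b. \<forall>v\<in>?S. \<forall>w\<in>?S.
        Q (?r `` {scale_form a v + scale_form b w}) = a * Q (?r `` {v}) + b * Q (?r `` {w})))"
    show "Q = R"
    proof (rule extensionalityI[of _ "?S // ?r"])
      \<comment> \<open>Every class is the class of some \<open>w\<close>, where both maps take the
        value \<open>reg_integral X A D w\<close>.\<close>
      show "Q C = R C" if "C \<in> ?S // ?r" for C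
        using that R Q by (auto elim!: quotientE)
    qed (use Q in \<open>auto simp: R_def\<close>)
  qed
qed

end
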